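(* Let $k\geq 2$ and let $n\geq 2$ be the largest natural number such that $k\geq\binom{n}{2}+1$. Then $\psi(k)\geq n$. Equivalently: for every surjective colouring $\Delta:\mathbb{N}^{(2)}\to[k]$, the set $\mathcal{F}_{\Delta}$ has at least $n$ elements.
   Context: For a set $X$, $X^{(2)}$ denotes the set of unordered pairs of elements of $X$ (the edges of the complete graph on $X$), and $[k]=\{1,\dots,k\}$. Given a surjective colouring $\Delta:\mathbb{N}^{(2)}\to[k]$, a set $X\subset\mathbb{N}$ is called (exactly) $m$-coloured if $\Delta(X^{(2)})$, the set of colours of edges with both endpoints in $X$, has exactly $m$ elements. Define $\mathcal{F}_{\Delta}=\{m\in[k] : \text{there is an infinite } m\text{-coloured } X\subset\mathbb{N}\}$ and $\psi(k)=\min|\mathcal{F}_{\Delta}|$, the minimum over all surjective colourings $\Delta:\mathbb{N}^{(2)}\to[k]$. *)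

theory Defs
  imports "HOL-Library.Ramsey"
begin

text \<open>
  A colouring is a function on all sets of natural numbers, of which only the values on
  two-element sets matter.
\<close>

definition surj_colouring :: "nat \<Rightarrow> (nat set \<Rightarrow> nat) \<Rightarrow> bool" where
  "surj_colouring k \<Delta> \<longleftrightarrow> \<Delta> ` [UNIV]\<^bsup>2\<^esup> = {1..k}"

definition exactly_coloured :: "(nat set \<Rightarrow> nat) \<Rightarrow> nat \<Rightarrow> nat set \<Rightarrow> bool" where
  "exactly_coloured \<Delta> m X \<longleftrightarrow> card (\<Delta> ` [X]\<^bsup>2\<^esup>) = m"

definition colour_counts :: "nat \<Rightarrow> (nat set \<Rightarrow> nat) \<Rightarrow> nat set" where
  "colour_counts k \<Delta> = {m \<in> {1..k}. \<exists>X. infinite X \<and> exactly_coloured \<Delta> m X}"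

definition psi :: "nat \<Rightarrow> nat" where
  "psi k = Min {card (colour_counts k \<Delta>) |\<Delta>. surj_colouring k \<Delta>}"

text \<open>
  The set whose minimum defines \<^const>\<open>psi\<close> is finite, and nonempty for \<open>k \<ge> 1\<close>,
  so that \<^const>\<open>Min\<close> is meaningful.
\<close>

lemma finite_psi_set: "finite {card (colour_counts k \<Delta>) |\<Delta>. surj_colouring k \<Delta>}"
proof (rule finite_subset)
  have "card (colour_counts k \<Delta>) \<le> k" for \<Delta>
  proof -
    have "colour_counts k \<Delta> \<subseteq> {1..k}"
      unfolding colour_counts_def by blast
    then show ?thesis
      using card_mono[of "{1..k}" "colour_counts k \<Delta>"] by simp
  qed
  then show "{card (colour_counts k \<Delta>) |\<Delta>. surj_colouring k \<Delta>} \<subseteq> {..k}"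
    by auto
qed simp

lemma surj_colouring_exists:
  assumes "1 \<le> k"
  shows "\<exists>\<Delta>. surj_colouring k \<Delta>"
proof
  let ?\<Delta> = "\<lambda>e::nat set. max 1 (min k (Max e))"
  have "c \<in> ?\<Delta> ` [UNIV]\<^bsup>2\<^esup>" if "c \<in> {1..k}" for c
    using that by (intro image_eqI[of _ _ "{0, c}"]) auto
  then show "surj_colouring k ?\<Delta>"
    using assms by (auto simp: surj_colouring_def)
qed

end

(* Choose a finite set F whose edges show all k colours and, by the pigeonhole principle and
   Ramsey's theorem, an infinite monochromatic Y disjoint from F such that each v in F sends a
   single colour to Y.  For S a subset of F let f S be the number of colours on S \<union> Y; thus
   f F = k.  For v in F let P v be the set of colours lost on deleting v from F.  Two sets P u and
   P v share at most the colour of the edge uv, and P v has at most |F| elements.  Hence if d is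
   the least size of a P v, any d of them contain together at least d + (d-1) + ... + 1 colours,
   none of which occurs inside Y, so f F \<ge> C(d+1,2) + 1.  Deleting the vertex that loses the
   fewest colours leaves f F - d.  If f F \<ge> C(n,2) + 1, this is at least C(n-1,2) + 1 when
   d < n, and at least C(d,2) + 1 \<ge> C(n,2) + 1 when d \<ge> n.  So by induction on F, f takes at
   least n values. *)

theory Submission
  imports Defs
begin

text \<open>Adding the sets one at a time, a new set meets the union of the earlier ones in at most
  one element per earlier set, so the i-th set contributes at least d - (i-1) new elements. The
  total deficit is put on the right as a binomial coefficient, which avoids truncated
  subtraction.\<close>

lemma card_UN_almost_disjoint_ge:
  assumes "finite I"
    and "\<And>i. i \<in> I \<Longrightarrow> finite (P i)"
    and "\<And>i. i \<in> I \<Longrightarrow> d \<le> card (P i)"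
    and "\<And>i j. i \<in> I \<Longrightarrow> j \<in> I \<Longrightarrow> i \<noteq> j \<Longrightarrow> card (P i \<inter> P j) \<le> 1"
  shows "d * card I \<le> card (\<Union>i\<in>I. P i) + (card I choose 2)"
  using assms
proof (induction I)
  case empty
  then show ?case by simp
next
  case (insert x I)
  let ?U = "\<Union>i\<in>I. P i"
  have IH: "d * card I \<le> card ?U + (card I choose 2)"
    by (rule insert.IH) (use insert.prems in blast)+
  have "card (P x \<inter> ?U) = card (\<Union>i\<in>I. P x \<inter> P i)"
    by (simp only: Int_UN_distrib)
  also have "\<dots> \<le> (\<Sum>i\<in>I. card (P x \<inter> P i))"
    using insert.hyps(1) by (rule card_UN_le)
  also have "\<dots> \<le> (\<Sum>i\<in>I. 1)"
    using insert.hyps(2) insert.prems(3) by (intro sum_mono) force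
  finally have inter: "card (P x \<inter> ?U) \<le> card I" by simp
  have "card (P x) + card ?U = card (P x \<union> ?U) + card (P x \<inter> ?U)"
    using insert.hyps insert.prems(1) by (intro card_Un_Int) auto
  moreover have "d \<le> card (P x)"
    using insert.prems by simp
  moreover have "card (insert x I) choose 2 = card I + (card I choose 2)"
    using insert.hyps by (simp add: numeral_2_eq_2)
  moreover have "d * card (insert x I) = d + d * card I"
    using insert.hyps by simp
  ultimately show ?case
    using IH inter by simp
qed

text \<open>Here \<open>d\<close> is any lower bound for the number of colours lost by deleting one
  vertex. A lost colour occurs only on edges through the deleted vertex, so a colour lost at both u
  and v can occur only on the edge uv; this makes the sets of lost colours almost disjoint.\<close>

lemma least_loss_bound:
  fixes \<Delta> :: "'a set \<Rightarrow> 'b"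
  assumes "finite F" and "infinite Y" and "F \<inter> Y = {}"
    and fin: "finite (\<Delta> ` [F \<union> Y]\<^bsup>2\<^esup>)"
    and const: "\<And>v y y'. v \<in> F \<Longrightarrow> y \<in> Y \<Longrightarrow> y' \<in> Y \<Longrightarrow> \<Delta> {v, y} = \<Delta> {v, y'}"
    and "F \<noteq> {}"
    and loss: "\<And>v. v \<in> F \<Longrightarrow>
      d + card (\<Delta> ` [F - {v} \<union> Y]\<^bsup>2\<^esup>) \<le> card (\<Delta> ` [F \<union> Y]\<^bsup>2\<^esup>)"
  shows "(Suc d choose 2) + 1 \<le> card (\<Delta> ` [F \<union> Y]\<^bsup>2\<^esup>)"
proof -
  define C where "C S = \<Delta> ` [S \<union> Y]\<^bsup>2\<^esup>" for S
  define P where "P v = C F - C (F - {v})" for v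
  have C_mono: "C S \<subseteq> C T" if "S \<subseteq> T" for S T
    unfolding C_def using that by (intro image_mono nsets_mono) auto
  have finC: "finite (C F)"
    using fin by (simp add: C_def)
  have finP: "finite (P v)" for v
    using finC by (simp add: P_def)
  have P_ge: "d \<le> card (P v)" if "v \<in> F" for v
  proof -
    have "card (P v) = card (C F) - card (C (F - {v}))"
      unfolding P_def using finC C_mono[of "F - {v}" F]
      by (intro card_Diff_subset) (auto intro: finite_subset)
    then show ?thesis
      using loss[OF that] by (simp add: C_def)
  qed
  have P_edge: "v \<in> e" if "\<Delta> e \<in> P v" "e \<in> [F \<union> Y]\<^bsup>2\<^esup>" for e v
  proof (rule ccontr)
    assume "v \<notin> e"
    then have "e \<in> [F - {v} \<union> Y]\<^bsup>2\<^esup>"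
      using that(2) by (auto simp: nsets_def)
    then show False
      using that(1) by (auto simp: P_def C_def)
  qed
  obtain y where y: "y \<in> Y"
    using \<open>infinite Y\<close> infinite_imp_nonempty by blast
  \<comment> \<open>This makes it possible to choose \<open>d\<close> vertices in \<open>F\<close>.
    The edges at v show at most |F| - 1 colours towards \<open>F\<close> and a single one towards
    \<open>Y\<close>, for which \<open>y\<close> stands in.\<close>
  have "d \<le> card F"
  proof -
    obtain v where v: "v \<in> F" using \<open>F \<noteq> {}\<close> by blast
    have "P v \<subseteq> (\<lambda>u. \<Delta> {v, u}) ` insert y (F - {v})"
    proof
      fix c assume c: "c \<in> P v"
      then obtain e where e: "e \<in> [F \<union> Y]\<^bsup>2\<^esup>" "c = \<Delta> e"
        by (auto simp: P_def C_def)
      then have "v \<in> e" using P_edge c by blast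
      then obtain u where u: "e = {v, u}" "u \<noteq> v" "u \<in> F \<union> Y"
        using e(1) by (auto simp: nsets_def card_2_iff)
      show "c \<in> (\<lambda>u. \<Delta> {v, u}) ` insert y (F - {v})"
      proof (cases "u \<in> F")
        case True
        then show ?thesis using u e by blast
      next
        case False
        then have "c = \<Delta> {v, y}"
          using const[OF v _ y, of u] u e by auto
        then show ?thesis by blast
      qed
    qed
    then have "card (P v) \<le> card (insert y (F - {v}))"
      using \<open>finite F\<close> by (intro surj_card_le) auto
    also have "\<dots> \<le> Suc (card (F - {v}))"
      by (rule card_insert_le_m1) auto
    also have "\<dots> = card F"
      using v \<open>finite F\<close> by (rule card_Suc_Diff1[rotated])
    finally show ?thesis using P_ge[OF v] by simp
  qed
  then obtain I where I: "I \<subseteq> F" "card I = d"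
    by (meson obtain_subset_with_card_n)
  have finI: "finite I"
    using I(1) \<open>finite F\<close> by (rule finite_subset)
  have P_inter: "card (P u \<inter> P v) \<le> 1" if "u \<noteq> v" for u v
  proof -
    have "P u \<inter> P v \<subseteq> {\<Delta> {u, v}}"
    proof
      fix c assume c: "c \<in> P u \<inter> P v"
      then obtain e where e: "e \<in> [F \<union> Y]\<^bsup>2\<^esup>" "c = \<Delta> e"
        by (auto simp: P_def C_def)
      then have "u \<in> e" "v \<in> e" using P_edge c by blast+
      then have "e = {u, v}"
        using e(1) that by (auto simp: nsets_def card_2_iff)
      then show "c \<in> {\<Delta> {u, v}}" using e by simp
    qed
    from card_mono[OF _ this] show ?thesis by simp
  qed
  have "d * card I \<le> card (\<Union>v\<in>I. P v) + (card I choose 2)"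
    using finI finP by (rule card_UN_almost_disjoint_ge) (use P_ge P_inter I(1) in auto)
  then have "d * d \<le> card (\<Union>v\<in>I. P v) + (d choose 2)"
    using I(2) by simp
  \<comment> \<open>Cancelling the deficit C(d,2) leaves d + (d-1) + ... + 1.\<close>
  moreover have "d * d = (Suc d choose 2) + (d choose 2)"
    by (induction d) (auto simp: numeral_2_eq_2)
  ultimately have P_many: "(Suc d choose 2) \<le> card (\<Union>v\<in>I. P v)"
    by simp
  \<comment> \<open>The colour of an edge inside \<open>Y\<close> survives every deletion, so it
    lies in no \<open>P v\<close> and supplies the summand 1.\<close>
  have "infinite (Y - {y})"
    using \<open>infinite Y\<close> by simp
  then obtain y' where y': "y' \<in> Y" "y' \<noteq> y"
    using infinite_imp_nonempty by blast
  then have base: "\<Delta> {y, y'} \<in> C S" for S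
    unfolding C_def using y by (intro imageI) simp
  have "insert (\<Delta> {y, y'}) (\<Union>v\<in>I. P v) \<subseteq> C F"
    using base by (auto simp: P_def)
  moreover have "\<Delta> {y, y'} \<notin> (\<Union>v\<in>I. P v)"
    using base by (auto simp: P_def)
  ultimately have "Suc (card (\<Union>v\<in>I. P v)) \<le> card (C F)"
    using finC finI finP card_mono[of "C F" "insert (\<Delta> {y, y'}) (\<Union>v\<in>I. P v)"] by simp
  then show ?thesis
    using P_many by (simp add: C_def)
qed

text \<open>The number \<open>n\<close> varies in the induction on \<open>F\<close>: deleting a
  vertex either keeps the threshold for \<open>n\<close>, or lowers it to that for n - 1 while
  \<open>F\<close> itself contributes a new value.\<close>

lemma card_colour_numbers_ge:
  fixes \<Delta> :: "'a set \<Rightarrow> 'b"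
  assumes "finite F" and "infinite Y" and "F \<inter> Y = {}"
    and "finite (\<Delta> ` [F \<union> Y]\<^bsup>2\<^esup>)"
    and "\<And>v y y'. v \<in> F \<Longrightarrow> y \<in> Y \<Longrightarrow> y' \<in> Y \<Longrightarrow> \<Delta> {v, y} = \<Delta> {v, y'}"
    and "card (\<Delta> ` [Y]\<^bsup>2\<^esup>) \<le> 1"
    and "(n choose 2) + 1 \<le> card (\<Delta> ` [F \<union> Y]\<^bsup>2\<^esup>)"
  shows "n \<le> card ((\<lambda>S. card (\<Delta> ` [S \<union> Y]\<^bsup>2\<^esup>)) ` Pow F)"
  using assms
proof (induction F arbitrary: n rule: finite_psubset_induct)
  case (psubset F)
  let ?f = "\<lambda>S. card (\<Delta> ` [S \<union> Y]\<^bsup>2\<^esup>)"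
  show ?case
  proof (cases "F = {}")
    case True
    \<comment> \<open>Only edges inside \<open>Y\<close> remain, and they show at most one
      colour.\<close>
    then have "n choose 2 = 0"
      using psubset.prems(5,6) by (simp del: binomial_eq_0_iff)
    then have "n \<le> 1"
      by (simp add: binomial_eq_0_iff)
    then show ?thesis using True by simp
  next
    case False
    have mono: "?f S \<le> ?f F" if "S \<subseteq> F" for S
      using that psubset.prems(3) by (intro card_mono image_mono nsets_mono) auto
    obtain v where v: "v \<in> F" and v_max: "\<And>u. u \<in> F \<Longrightarrow> ?f (F - {u}) \<le> ?f (F - {v})"
    proof -
      let ?A = "(\<lambda>u. ?f (F - {u})) ` F"
      have "finite ?A" using psubset.hyps by (rule finite_imageI)
      have "Max ?A \<in> ?A"
        using \<open>finite ?A\<close> False by (intro Max_in) blast+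
      then obtain v where v: "v \<in> F" "Max ?A = ?f (F - {v})"
        by (rule imageE)
      show ?thesis
      proof (rule that[OF v(1)])
        fix u assume "u \<in> F"
        then show "?f (F - {u}) \<le> ?f (F - {v})"
          unfolding v(2)[symmetric] using \<open>finite ?A\<close> by (intro Max_ge imageI)
      qed
    qed
    have IH: "m \<le> card (?f ` Pow (F - {v}))" if "(m choose 2) + 1 \<le> ?f (F - {v})" for m
    proof (rule psubset.IH[OF _ psubset.prems(1) _ _ _ psubset.prems(5) that])
      show "F - {v} \<subset> F" using v by blast
      show "(F - {v}) \<inter> Y = {}" using psubset.prems(2) by blast
      show "finite (\<Delta> ` [F - {v} \<union> Y]\<^bsup>2\<^esup>)"
        using psubset.prems(3) by (rule finite_subset[rotated]) (intro image_mono nsets_mono, auto)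
      show "\<Delta> {u, y} = \<Delta> {u, y'}" if "u \<in> F - {v}" "y \<in> Y" "y' \<in> Y" for u y y'
        using that by (intro psubset.prems(4)) auto
    qed
    have sub: "?f ` Pow (F - {v}) \<subseteq> ?f ` Pow F"
      by (intro image_mono) auto
    have fin: "finite (?f ` Pow F)"
      using psubset.hyps by simp
    define d where "d = ?f F - ?f (F - {v})"
    have d: "d + ?f (F - {v}) = ?f F"
      using mono[of "F - {v}"] by (auto simp: d_def)
    have d_bound: "(Suc d choose 2) + 1 \<le> ?f F"
    proof (rule least_loss_bound[OF psubset.hyps psubset.prems(1-4) False])
      fix u assume "u \<in> F"
      from v_max[OF this] show "d + ?f (F - {u}) \<le> ?f F"
        using d by linarith
    qed
    show ?thesis
    proof (cases "d = 0 \<or> n \<le> d")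
      case True
      \<comment> \<open>If d = 0 nothing is lost. Otherwise \<open>d_bound\<close> leaves at least
        C(d+1,2) + 1 - d = C(d,2) + 1 colours, and n \<le> d.\<close>
      have "(n choose 2) + 1 \<le> ?f (F - {v})"
      proof (cases "d = 0")
        case False
        then have "n choose 2 \<le> d choose 2"
          using True by (intro binomial_right_mono) auto
        then show ?thesis
          using d d_bound by (simp add: numeral_2_eq_2)
      qed (use d psubset.prems in simp)
      from IH[OF this] show ?thesis
        using card_mono[OF fin sub] by linarith
    next
      case False
      then obtain m where m: "n = Suc m"
        by (cases n) auto
      \<comment> \<open>Now 0 < d < n, so at most m = n - 1 colours are lost, and C(n,2) - m =
        C(m,2).\<close>
      have "(m choose 2) + 1 \<le> ?f (F - {v})"
        using d psubset.prems(6) False m by (simp add: numeral_2_eq_2)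
      from IH[OF this] have "m \<le> card (?f ` Pow (F - {v}))" .
      \<comment> \<open>Since d > 0, every subset avoiding \<open>v\<close> shows strictly fewer
        colours than \<open>F\<close>.\<close>
      moreover have "?f F \<notin> ?f ` Pow (F - {v})"
      proof
        assume "?f F \<in> ?f ` Pow (F - {v})"
        then obtain S where S: "S \<subseteq> F - {v}" "?f F = ?f S" by blast
        have "?f S \<le> ?f (F - {v})"
          using S(1) psubset.prems(3)
          by (intro card_mono image_mono nsets_mono finite_subset[OF _ psubset.prems(3)]) auto
        then show False using S d False by simp
      qed
      moreover have "insert (?f F) (?f ` Pow (F - {v})) \<subseteq> ?f ` Pow F"
        using sub by auto
      ultimately show ?thesis
        using card_mono[OF fin, of "insert (?f F) (?f ` Pow (F - {v}))"] psubset.hyps m by simp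
    qed
  qed
qed

lemma card_colour_counts_ge:
  assumes "surj_colouring k \<Delta>" and "(n choose 2) + 1 \<le> k"
  shows "n \<le> card (colour_counts k \<Delta>)"
proof -
  have colours: "\<Delta> ` [UNIV]\<^bsup>2\<^esup> = {1..k}"
    using assms(1) by (simp add: surj_colouring_def)
  \<comment> \<open>It suffices to take one edge of each colour; \<open>F\<close> consists of their
    endpoints.\<close>
  obtain E where E: "E \<subseteq> [UNIV]\<^bsup>2\<^esup>" "finite E" "\<Delta> ` E = {1..k}"
    using finite_subset_image[of "{1..k}" \<Delta> "[UNIV]\<^bsup>2\<^esup>"] colours by auto
  define F where "F = \<Union>E"
  have finF: "finite F"
    using E(1,2) by (auto simp: F_def nsets_def)
  \<comment> \<open>\<open>g y\<close> records the colours that y sends to \<open>F\<close>.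
    Restricting it to \<open>F\<close> puts it in a finite function space, so some fibre of
    \<open>g\<close> outside \<open>F\<close> is infinite.\<close>
  define g where "g y = restrict (\<lambda>v. \<Delta> {v, y}) F" for y
  have "g ` (- F) \<subseteq> F \<rightarrow>\<^sub>E {1..k}"
  proof (clarsimp simp: g_def)
    fix y v assume "y \<notin> F" "v \<in> F"
    then have "v \<noteq> y" by blast
    then have "{v, y} \<in> [UNIV]\<^bsup>2\<^esup>" by simp
    then have "\<Delta> {v, y} \<in> {1..k}" using colours by blast
    then show "Suc 0 \<le> \<Delta> {v, y} \<and> \<Delta> {v, y} \<le> k" by simp
  qed
  then have "finite (g ` (- F))"
    by (rule finite_subset) (use finF in \<open>auto intro: finite_PiE\<close>)
  moreover have "infinite (- F)"
    using finF by (simp add: Compl_eq_Diff_UNIV)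
  ultimately obtain x where x: "infinite {y \<in> - F. g y = g x}"
    using pigeonhole_infinite by blast
  define Z where "Z = {y \<in> - F. g y = g x}"
  \<comment> \<open>\<open>Ramsey2\<close> expects colours below a strict bound, hence
    \<open>Suc k\<close>.\<close>
  have "\<forall>y\<in>Z. \<forall>y'\<in>Z. y \<noteq> y' \<longrightarrow> \<Delta> {y, y'} < Suc k"
  proof (intro ballI impI)
    fix y y' :: nat assume "y \<noteq> y'"
    then have "{y, y'} \<in> [UNIV]\<^bsup>2\<^esup>" by simp
    then have "\<Delta> {y, y'} \<in> {1..k}" using colours by blast
    then show "\<Delta> {y, y'} < Suc k" by simp
  qed
  then obtain Y c where Y: "Y \<subseteq> Z" "infinite Y"
      and Yc: "\<forall>y\<in>Y. \<forall>y'\<in>Y. y \<noteq> y' \<longrightarrow> \<Delta> {y, y'} = c"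
    using Ramsey2[of Z \<Delta> "Suc k"] x by (auto simp: Z_def)
  have "\<Delta> ` [Y]\<^bsup>2\<^esup> \<subseteq> {c}"
    using Yc by (auto simp: nsets_def card_2_iff)
  then have mono_Y: "card (\<Delta> ` [Y]\<^bsup>2\<^esup>) \<le> 1"
    using card_mono[of "{c}"] by simp
  have const: "\<Delta> {v, y} = \<Delta> {v, y'}" if "v \<in> F" "y \<in> Y" "y' \<in> Y" for v y y'
  proof -
    have "g y = g x" "g y' = g x" using Y(1) that by (auto simp: Z_def)
    then have "g y v = g y' v" by simp
    then show ?thesis using that by (simp add: g_def)
  qed
  have bounded: "\<Delta> ` [X]\<^bsup>2\<^esup> \<subseteq> {1..k}" for X
    unfolding colours[symmetric] by (intro image_mono nsets_mono subset_UNIV)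
  have "E \<subseteq> [F \<union> Y]\<^bsup>2\<^esup>"
    using E(1) by (auto simp: F_def nsets_def)
  then have "\<Delta> ` [F \<union> Y]\<^bsup>2\<^esup> = {1..k}"
    using bounded E(3) by (metis image_mono subset_antisym)
  then have "n \<le> card ((\<lambda>S. card (\<Delta> ` [S \<union> Y]\<^bsup>2\<^esup>)) ` Pow F)"
    using assms(2) finF Y mono_Y
    by (intro card_colour_numbers_ge const) (auto simp: Z_def)
  also have "\<dots> \<le> card (colour_counts k \<Delta>)"
  proof (rule card_mono)
    show "finite (colour_counts k \<Delta>)"
      by (simp add: colour_counts_def)
    show "(\<lambda>S. card (\<Delta> ` [S \<union> Y]\<^bsup>2\<^esup>)) ` Pow F \<subseteq> colour_counts k \<Delta>"
    proof (rule image_subsetI)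
      fix S
      \<comment> \<open>Infinite sets have edges, so the count is at least 1, as membership in
        \<open>colour_counts\<close> demands.\<close>
      have "infinite (S \<union> Y)" using Y by simp
      then have "[S \<union> Y]\<^bsup>2\<^esup> \<noteq> {}"
        by (simp add: nsets_eq_empty_iff)
      moreover have "finite (\<Delta> ` [S \<union> Y]\<^bsup>2\<^esup>)"
        using bounded finite_subset by blast
      ultimately have "1 \<le> card (\<Delta> ` [S \<union> Y]\<^bsup>2\<^esup>)"
        by (simp add: Suc_le_eq card_gt_0_iff)
      moreover have "card (\<Delta> ` [S \<union> Y]\<^bsup>2\<^esup>) \<le> k"
        using card_mono[OF _ bounded] by simp
      ultimately show "card (\<Delta> ` [S \<union> Y]\<^bsup>2\<^esup>) \<in> colour_counts k \<Delta>"
        using \<open>infinite (S \<union> Y)\<close> by (auto simp: colour_counts_def exactly_coloured_def)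
    qed
  qed
  finally show ?thesis .
qed

theorem theorem1:
  fixes k n :: nat
  assumes "k \<ge> 2"
    and "n \<ge> 2"
    and "k \<ge> (n choose 2) + 1"
    and "\<forall>m. k \<ge> (m choose 2) + 1 \<longrightarrow> m \<le> n"
  shows "psi k \<ge> n \<and>
    (\<forall>\<Delta>. surj_colouring k \<Delta> \<longrightarrow> card (colour_counts k \<Delta>) \<ge> n)"
proof -
  have all: "n \<le> card (colour_counts k \<Delta>)" if "surj_colouring k \<Delta>" for \<Delta>
    using that assms(3) by (rule card_colour_counts_ge)
  \<comment> \<open>Nonemptiness is what lets a bound on all members pass to their
    \<open>Min\<close>.\<close>
  have "{card (colour_counts k \<Delta>) |\<Delta>. surj_colouring k \<Delta>} \<noteq> {}"
    using surj_colouring_exists[of k] assms(1) by auto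
  then have "n \<le> psi k"
    unfolding psi_def using all by (intro Min.boundedI finite_psi_set) auto
  then show ?thesis using all by blast
qed

end
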